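(* Let $F_Y$ be the free group on a set $Y$ and let $H<K\le F_Y$ be subgroups with $H$ strictly contained in $K$. Then there is a basis $B$ of $F_Y$ such that the graph morphism $\Gamma_B(H)\to\Gamma_B(K)$ is not injective.
   Context: Graphs are in the sense of Serre: a graph $\Gamma$ has a vertex set $V(\Gamma)$, an edge set $E(\Gamma)$, an initial vertex map $\iota:E(\Gamma)\to V(\Gamma)$ and an involution $e\mapsto\overline e$ on $E(\Gamma)$ with $\overline e\ne e$. A graph morphism is a pair of maps on vertices and edges commuting with $\iota$ and the involution; it is injective if it is injective on vertices and on edges. A path is a finite sequence of edges $e_1,\dots,e_n$ with $\iota(\overline{e_k})=\iota(e_{k+1})$; it is closed if $\iota(\overline{e_n})=\iota(e_1)$, and reduced if $e_{k+1}\neq\overline{e_k}$ for all $k$. Graphs are assumed connected. For a set $B$, a $B$-labeled graph is a graph with a label map $l:E(\Gamma)\to B\cup B^{-1}$ satisfying $l(\overline e)=l(e)^{-1}$; the label of a path $e_1,\dots,e_n$ is $l(e_1)\cdots l(e_n)$ in the free group on $B$. A pointed labeled graph has a distinguished base point; morphisms of pointed labeled graphs preserve labels and base points. For a pointed $B$-labeled graph, $\pi_1(\Gamma)$ denotes the set of labels of closed paths starting at the base point; it is a subgroup of the free group on $B$. A labeled graph is folded if distinct edges with the same initial vertex have distinct labels. A core graph is a connected pointed folded labeled graph in which every edge belongs to a closed reduced path starting at the base point. Given a basis $B$ of a free group $F$ (so $F$ is identified with the free group on $B$) and a subgroup $H\le F$, $\Gamma_B(H)$ is the $B$-labeled core graph,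 unique up to unique isomorphism, with $\pi_1(\Gamma_B(H))=H$. If $H\le K\le F$, there is a unique morphism of pointed $B$-labeled graphs $\Gamma_B(H)\to\Gamma_B(K)$.
   Formalization: The subgroup H is additionally assumed nontrivial; for H = 1 the claim fails, since the core graph of the trivial subgroup is a single vertex for every basis B and its morphism to the core graph of K is always injective. *)

theory Defs
  imports "HOL-Algebra.Group"
begin

section \<open>Free groups and their bases\<close>

text \<open>The letter \<open>(y, True)\<close> stands for \<open>y\<close> and \<open>(y, False)\<close> for its formal inverse. Elements of
  the free group are reduced words.\<close>

type_synonym 'a word = "('a \<times> bool) list"

definition letter_inv :: "'a \<times> bool \<Rightarrow> 'a \<times> bool" where
  "letter_inv x = (fst x, \<not> snd x)"

definition reduced_word :: "'a word \<Rightarrow> bool" where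
  "reduced_word w \<longleftrightarrow> (\<forall>k. Suc k < length w \<longrightarrow> w ! Suc k \<noteq> letter_inv (w ! k))"

fun red_cons :: "'a \<times> bool \<Rightarrow> 'a word \<Rightarrow> 'a word" where
  "red_cons x [] = [x]"
| "red_cons x (y # w) = (if y = letter_inv x then w else x # y # w)"

definition free_group :: "'a set \<Rightarrow> 'a word monoid" where
  "free_group Y = \<lparr>carrier = {w. set w \<subseteq> Y \<times> UNIV \<and> reduced_word w},
                   monoid.mult = (\<lambda>u v. foldr red_cons u v),
                   one = []\<rparr>"

definition word_eval :: "('g, 'm) monoid_scheme \<Rightarrow> 'g word \<Rightarrow> 'g" where
  "word_eval F w =
     foldr (\<lambda>(b, s) g. (if s then b else inv\<^bsub>F\<^esub> b) \<otimes>\<^bsub>F\<^esub> g) w \<one>\<^bsub>F\<^esub>"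

definition free_basis :: "('g, 'm) monoid_scheme \<Rightarrow> 'g set \<Rightarrow> bool" where
  "free_basis F B \<longleftrightarrow> B \<subseteq> carrier F \<and> word_eval F \<in> iso (free_group B) F"

section \<open>Pointed labeled graphs in the sense of Serre\<close>

text \<open>For a basis \<open>B\<close> of \<open>F\<close>, labels in \<open>B \<union> B\<inverse>\<close> are taken as elements of \<open>F\<close> itself, so
  that the label of a path is a product in \<open>F\<close>.\<close>

record ('v, 'e, 'g) pl_graph =
  verts :: "'v set"
  edges :: "'e set"
  init :: "'e \<Rightarrow> 'v"
  bar :: "'e \<Rightarrow> 'e"
  lab :: "'e \<Rightarrow> 'g"
  base :: 'v

definition term_vert :: "('v, 'e, 'g) pl_graph \<Rightarrow> 'e \<Rightarrow> 'v" where
  "term_vert \<Gamma> e = init \<Gamma> (bar \<Gamma> e)"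

definition serre_graph :: "('v, 'e, 'g) pl_graph \<Rightarrow> bool" where
  "serre_graph \<Gamma> \<longleftrightarrow>
     (\<forall>e \<in> edges \<Gamma>. init \<Gamma> e \<in> verts \<Gamma> \<and> bar \<Gamma> e \<in> edges \<Gamma> \<and>
                   bar \<Gamma> e \<noteq> e \<and> bar \<Gamma> (bar \<Gamma> e) = e)"

fun path :: "('v, 'e, 'g) pl_graph \<Rightarrow> 'v \<Rightarrow> 'e list \<Rightarrow> 'v \<Rightarrow> bool" where
  "path \<Gamma> u [] v \<longleftrightarrow> u \<in> verts \<Gamma> \<and> u = v"
| "path \<Gamma> u (e # es) v \<longleftrightarrow> e \<in> edges \<Gamma> \<and> init \<Gamma> e = u \<and> path \<Gamma> (term_vert \<Gamma> e) es v"

definition reduced_path :: "('v, 'e, 'g) pl_graph \<Rightarrow> 'e list \<Rightarrow> bool" where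
  "reduced_path \<Gamma> es \<longleftrightarrow> (\<forall>k. Suc k < length es \<longrightarrow> es ! Suc k \<noteq> bar \<Gamma> (es ! k))"

definition connected_graph :: "('v, 'e, 'g) pl_graph \<Rightarrow> bool" where
  "connected_graph \<Gamma> \<longleftrightarrow> (\<forall>u \<in> verts \<Gamma>. \<forall>v \<in> verts \<Gamma>. \<exists>es. path \<Gamma> u es v)"

definition pointed_labeled_graph ::
  "('g, 'm) monoid_scheme \<Rightarrow> 'g set \<Rightarrow> ('v, 'e, 'g) pl_graph \<Rightarrow> bool" where
  "pointed_labeled_graph F B \<Gamma> \<longleftrightarrow>
     serre_graph \<Gamma> \<and> base \<Gamma> \<in> verts \<Gamma> \<and>
     (\<forall>e \<in> edges \<Gamma>. lab \<Gamma> e \<in> B \<union> m_inv F ` B \<and> lab \<Gamma> (bar \<Gamma> e) = inv\<^bsub>F\<^esub> (lab \<Gamma> e))"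

definition path_label ::
  "('g, 'm) monoid_scheme \<Rightarrow> ('v, 'e, 'g) pl_graph \<Rightarrow> 'e list \<Rightarrow> 'g" where
  "path_label F \<Gamma> es = foldr (\<lambda>e g. lab \<Gamma> e \<otimes>\<^bsub>F\<^esub> g) es \<one>\<^bsub>F\<^esub>"

definition pi1 :: "('g, 'm) monoid_scheme \<Rightarrow> ('v, 'e, 'g) pl_graph \<Rightarrow> 'g set" where
  "pi1 F \<Gamma> = {path_label F \<Gamma> es | es. path \<Gamma> (base \<Gamma>) es (base \<Gamma>)}"

definition folded :: "('v, 'e, 'g) pl_graph \<Rightarrow> bool" where
  "folded \<Gamma> \<longleftrightarrow>
     (\<forall>e \<in> edges \<Gamma>. \<forall>f \<in> edges \<Gamma>. e \<noteq> f \<and> init \<Gamma> e = init \<Gamma> f \<longrightarrow> lab \<Gamma> e \<noteq> lab \<Gamma> f)"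

definition core_graph ::
  "('g, 'm) monoid_scheme \<Rightarrow> 'g set \<Rightarrow> ('v, 'e, 'g) pl_graph \<Rightarrow> bool" where
  "core_graph F B \<Gamma> \<longleftrightarrow>
     pointed_labeled_graph F B \<Gamma> \<and> connected_graph \<Gamma> \<and> folded \<Gamma> \<and>
     (\<forall>e \<in> edges \<Gamma>. \<exists>es. path \<Gamma> (base \<Gamma>) es (base \<Gamma>) \<and> reduced_path \<Gamma> es \<and> e \<in> set es)"

text \<open>\<open>is_core_graph_of F B H \<Gamma>\<close> says that \<open>\<Gamma>\<close> is a representative of the isomorphism class
  \<open>\<Gamma>\<^sub>B(H)\<close>.\<close>

definition is_core_graph_of ::
  "('g, 'm) monoid_scheme \<Rightarrow> 'g set \<Rightarrow> 'g set \<Rightarrow> ('v, 'e, 'g) pl_graph \<Rightarrow> bool" where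
  "is_core_graph_of F B H \<Gamma> \<longleftrightarrow> core_graph F B \<Gamma> \<and> pi1 F \<Gamma> = H"

text \<open>A fixed universe for representatives of \<open>\<Gamma>\<^sub>B(H)\<close>, large enough for all subgroups of the free
  group: vertices can be taken to be cosets and edges to be pairs of a coset and a label.\<close>

type_synonym 'y coset_graph = "('y word set, 'y word set \<times> 'y word, 'y word) pl_graph"

definition pl_morphism ::
  "('v, 'e, 'g) pl_graph \<Rightarrow> ('w, 'f, 'g) pl_graph \<Rightarrow> ('v \<Rightarrow> 'w) \<times> ('e \<Rightarrow> 'f) \<Rightarrow> bool" where
  "pl_morphism \<Gamma> \<Delta> \<phi> \<longleftrightarrow>
     fst \<phi> ` verts \<Gamma> \<subseteq> verts \<Delta> \<and> snd \<phi> ` edges \<Gamma> \<subseteq> edges \<Delta> \<and>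
     (\<forall>e \<in> edges \<Gamma>. init \<Delta> (snd \<phi> e) = fst \<phi> (init \<Gamma> e) \<and>
                   bar \<Delta> (snd \<phi> e) = snd \<phi> (bar \<Gamma> e) \<and>
                   lab \<Delta> (snd \<phi> e) = lab \<Gamma> e) \<and>
     fst \<phi> (base \<Gamma>) = base \<Delta>"

definition injective_morphism ::
  "('v, 'e, 'g) pl_graph \<Rightarrow> ('v \<Rightarrow> 'w) \<times> ('e \<Rightarrow> 'f) \<Rightarrow> bool" where
  "injective_morphism \<Gamma> \<phi> \<longleftrightarrow> inj_on (fst \<phi>) (verts \<Gamma>) \<and> inj_on (snd \<phi>) (edges \<Gamma>)"

section \<open>The reduced words form a group, with the one-letter words as a basis\<close>

lemma letter_inv_invol [simp]: "letter_inv (letter_inv x) = x"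
  by (simp add: letter_inv_def)

lemma letter_inv_neq [simp]: "letter_inv x \<noteq> x" "x \<noteq> letter_inv x"
  by (auto simp: letter_inv_def prod_eq_iff)

lemma reduced_word_Nil [simp]: "reduced_word []"
  by (simp add: reduced_word_def)

lemma reduced_word_Cons:
  "reduced_word (x # w) \<longleftrightarrow> reduced_word w \<and> (w = [] \<or> hd w \<noteq> letter_inv x)"
proof (cases w)
  case (Cons y v)
  have all_nat: "(\<forall>k. P k) \<longleftrightarrow> P 0 \<and> (\<forall>k. P (Suc k))" for P :: "nat \<Rightarrow> bool"
    by (metis not0_implies_Suc)
  have "reduced_word (x # w) \<longleftrightarrow> w ! 0 \<noteq> letter_inv x \<and> reduced_word w"
    unfolding reduced_word_def by (subst all_nat) (simp add: Cons)
  then show ?thesis by (auto simp: Cons)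
qed (simp add: reduced_word_def)

lemma reduced_red_cons: "reduced_word w \<Longrightarrow> reduced_word (red_cons x w)"
  by (cases w) (auto simp: reduced_word_Cons)

lemma set_red_cons: "set (red_cons x w) \<subseteq> insert x (set w)"
  by (cases w) auto

lemma red_cons_cancel: "reduced_word w \<Longrightarrow> red_cons x (red_cons (letter_inv x) w) = w"
proof (cases w)
  case (Cons y v)
  then show "reduced_word w \<Longrightarrow> ?thesis" by (cases v) (auto simp: reduced_word_Cons)
qed auto

lemma reduced_foldr_red_cons: "reduced_word v \<Longrightarrow> reduced_word (foldr red_cons u v)"
  by (induction u) (auto simp: reduced_red_cons)

lemma set_foldr_red_cons: "set (foldr red_cons u v) \<subseteq> set u \<union> set v"
proof (induction u)
  case (Cons x u)
  then show ?case using set_red_cons[of x "foldr red_cons u v"] by auto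
qed auto

lemma foldr_red_cons_Nil: "reduced_word u \<Longrightarrow> foldr red_cons u [] = u"
proof (induction u)
  case (Cons x u)
  then show ?case by (cases u) (auto simp: reduced_word_Cons)
qed auto

lemma foldr_red_cons_red_cons:
  assumes "reduced_word w"
  shows "foldr red_cons (red_cons x u) w = red_cons x (foldr red_cons u w)"
proof (cases u)
  case (Cons y v)
  then show ?thesis
    using red_cons_cancel[OF reduced_foldr_red_cons[OF assms], of x v] by auto
qed auto

lemma foldr_red_cons_assoc:
  assumes "reduced_word w"
  shows "foldr red_cons (foldr red_cons u v) w = foldr red_cons u (foldr red_cons v w)"
  by (induction u) (simp_all add: foldr_red_cons_red_cons[OF assms])

lemma foldr_red_cons_inverse:
  "reduced_word w \<Longrightarrow> foldr red_cons (map letter_inv (rev u)) (foldr red_cons u w) = w"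
proof (induction u arbitrary: w)
  case (Cons x u)
  have "red_cons (letter_inv x) (red_cons x v) = v" if "reduced_word v" for v
    using red_cons_cancel[OF that, of "letter_inv x"] by simp
  with Cons show ?case by (simp add: reduced_foldr_red_cons)
qed auto

lemma reduced_word_inverse: "reduced_word u \<Longrightarrow> reduced_word (map letter_inv (rev u))"
  unfolding reduced_word_def
proof (intro allI impI)
  fix k
  assume u: "\<forall>k. Suc k < length u \<longrightarrow> u ! Suc k \<noteq> letter_inv (u ! k)"
    and k: "Suc k < length (map letter_inv (rev u))"
  define j where "j = length u - Suc (Suc k)"
  have "Suc j < length u" "length u - Suc k = Suc j" "length u - Suc (Suc k) = j"
    using k by (auto simp: j_def)
  moreover have "u ! Suc j \<noteq> letter_inv (u ! j)" using u calculation by blast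
  ultimately show
    "map letter_inv (rev u) ! Suc k \<noteq> letter_inv (map letter_inv (rev u) ! k)"
    using k by (auto simp: rev_nth)
qed

lemma group_free_group: "group (free_group Y)"
proof (rule groupI)
  fix x assume x: "x \<in> carrier (free_group Y)"
  let ?y = "map letter_inv (rev x)"
  have "?y \<in> carrier (free_group Y)"
    using x reduced_word_inverse by (auto simp: free_group_def letter_inv_def)
  moreover have "?y \<otimes>\<^bsub>free_group Y\<^esub> x = \<one>\<^bsub>free_group Y\<^esub>"
    using x foldr_red_cons_inverse[of "[]" x] by (simp add: free_group_def foldr_red_cons_Nil)
  ultimately show "\<exists>y\<in>carrier (free_group Y). y \<otimes>\<^bsub>free_group Y\<^esub> x = \<one>\<^bsub>free_group Y\<^esub>"
    by blast
next
  fix x y assume "x \<in> carrier (free_group Y)" "y \<in> carrier (free_group Y)"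
  then show "x \<otimes>\<^bsub>free_group Y\<^esub> y \<in> carrier (free_group Y)"
    using set_foldr_red_cons[of x y] by (auto simp: free_group_def reduced_foldr_red_cons)
qed (auto simp: free_group_def foldr_red_cons_assoc)

lemma inv_letter_free_group:
  assumes "y \<in> Y"
  shows "inv\<^bsub>free_group Y\<^esub> [(y, True)] = [(y, False)]"
proof -
  interpret group "free_group Y" by (rule group_free_group)
  show ?thesis
    using assms by (intro inv_equality)
      (auto simp: free_group_def reduced_word_def letter_inv_def)
qed

lemma word_eval_free_group:
  assumes "set w \<subseteq> (\<lambda>y. [(y, True)]) ` Y \<times> UNIV"
  shows "word_eval (free_group Y) w = foldr red_cons (map (\<lambda>(b, s). (fst (hd b), s)) w) []"
  using assms
proof (induction w)
  case (Cons x w)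
  obtain y s where x: "x = ([(y, True)], s)" "y \<in> Y"
    using Cons.prems by (cases x) auto
  have IH: "word_eval (free_group Y) w = foldr red_cons (map (\<lambda>(b, s). (fst (hd b), s)) w) []"
    using Cons by simp
  have m: "monoid.mult (free_group Y) u v = foldr red_cons u v" for u v :: "'a word"
    by (simp add: free_group_def)
  have "word_eval (free_group Y) (x # w) =
      monoid.mult (free_group Y) [(y, s)] (word_eval (free_group Y) w)"
    using x by (simp add: word_eval_def inv_letter_free_group)
  then show ?case using x by (simp add: m IH)
qed (simp add: word_eval_def free_group_def)

lemma free_basis_letters: "free_basis (free_group Y) ((\<lambda>y. [(y, True)]) ` Y)"
proof -
  let ?B = "(\<lambda>y. [(y, True)]) ` Y" and ?h = "\<lambda>(b :: 'a word, s :: bool). (fst (hd b), s)"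
    and ?k = "\<lambda>(y :: 'a, s :: bool). ([(y, True)], s)"
  have hk: "?h (?k x) = x" for x by (cases x) auto
  have kh: "?k (?h x) = x" if "x \<in> ?B \<times> UNIV" for x using that by auto
  have hinv: "?h (letter_inv x) = letter_inv (?h x)" for x
    by (cases x) (auto simp: letter_inv_def)
  have inj: "?h x = letter_inv (?h z) \<longleftrightarrow> x = letter_inv z"
    if "x \<in> ?B \<times> UNIV" "z \<in> ?B \<times> UNIV" for x z
    using that by (auto simp: letter_inv_def)
  have rc: "map ?h (red_cons x w) = red_cons (?h x) (map ?h w)"
    if "set (x # w) \<subseteq> ?B \<times> UNIV" for x w
  proof (cases w)
    case (Cons z v)
    then show ?thesis using that inj[of z x] by auto
  qed auto
  have fold: "map ?h (foldr red_cons u v) = foldr red_cons (map ?h u) (map ?h v)"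
    if "set u \<subseteq> ?B \<times> UNIV" "set v \<subseteq> ?B \<times> UNIV" for u v
    using that(1)
  proof (induction u)
    case (Cons x u)
    have "set (foldr red_cons u v) \<subseteq> ?B \<times> UNIV"
      using set_foldr_red_cons[of u v] Cons.prems that by auto
    then show ?case using Cons rc[of x "foldr red_cons u v"] by simp
  qed simp
  have red: "reduced_word (map ?h w) \<longleftrightarrow> reduced_word w" if "set w \<subseteq> ?B \<times> UNIV" for w
    unfolding reduced_word_def
  proof (intro iff_allI, goal_cases)
    case (1 k)
    show ?case
    proof (cases "Suc k < length w")
      case True
      then have "w ! Suc k \<in> ?B \<times> UNIV" "w ! k \<in> ?B \<times> UNIV"
        using that nth_mem[of "Suc k" w] nth_mem[of k w] by auto
      from inj[OF this] True show ?thesis by simp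
    qed auto
  qed
  have ev: "word_eval (free_group Y) w = map ?h w" if "w \<in> carrier (free_group ?B)" for w
    using that red[of w] word_eval_free_group[of w Y]
    by (auto simp: free_group_def foldr_red_cons_Nil)
  have car: "map ?h w \<in> carrier (free_group Y)" if "w \<in> carrier (free_group ?B)" for w
    using that red[of w] by (force simp: free_group_def)
  have "word_eval (free_group Y) \<in> hom (free_group ?B) (free_group Y)"
  proof (rule homI)
    fix u v assume uv: "u \<in> carrier (free_group ?B)" "v \<in> carrier (free_group ?B)"
    have "u \<otimes>\<^bsub>free_group ?B\<^esub> v \<in> carrier (free_group ?B)"
      using group.is_monoid[OF group_free_group[of ?B]] uv by (simp add: monoid.m_closed)
    then show "word_eval (free_group Y) (u \<otimes>\<^bsub>free_group ?B\<^esub> v) =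
        word_eval (free_group Y) u \<otimes>\<^bsub>free_group Y\<^esub> word_eval (free_group Y) v"
      using uv ev fold[of u v] by (simp add: free_group_def)
  qed (use ev car in auto)
  moreover have "bij_betw (map ?h) (carrier (free_group ?B)) (carrier (free_group Y))"
  proof (rule bij_betwI[where g = "map ?k"])
    show "map ?h \<in> carrier (free_group ?B) \<rightarrow> carrier (free_group Y)" using car by auto
    show "map ?k \<in> carrier (free_group Y) \<rightarrow> carrier (free_group ?B)"
    proof
      fix w assume w: "w \<in> carrier (free_group Y)"
      have 1: "set (map ?k w) \<subseteq> ?B \<times> UNIV" using w by (auto simp: free_group_def)
      have 2: "map ?h (map ?k w) = w" using hk by (simp add: comp_def)
      show "map ?k w \<in> carrier (free_group ?B)"
        using red[OF 1] 1 w unfolding 2 by (simp add: free_group_def)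
    qed
    show "map ?k (map ?h w) = w" if "w \<in> carrier (free_group ?B)" for w
      using that kh by (auto simp: free_group_def intro!: map_idI)
    show "map ?h (map ?k w) = w" for w using hk by (simp add: comp_def)
  qed
  then have "bij_betw (word_eval (free_group Y)) (carrier (free_group ?B)) (carrier (free_group Y))"
    using ev by (subst bij_betw_cong[where g = "map ?h"]) auto
  moreover have "?B \<subseteq> carrier (free_group Y)"
    by (auto simp: free_group_def reduced_word_def)
  ultimately show ?thesis by (simp add: free_basis_def iso_def)
qed

end

(*
  Replacing a basis by its conjugate by w moves the base point of Gamma_B(H) from H to the coset Hw
  and adds to the core the segment leading there. Two vertices Hg and Hkg with k in K - H always lie
  over the same vertex of Gamma_B(K), so it is enough to choose w such that the segment together with
  the core contains such a pair, the base point being one of its members. Concretely, take a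
  cyclically reduced conjugate c = g^-1 h g of an element h of H and a shortest k with g k g^-1 in
  K - H. Neither c nor c^-1 cancels completely against k, so k^-1 c c k is the concatenation of the
  reduced words k^-1 c and c k. For w = g k this word represents h^2, its prefix k^-1 c represents
  an element of K - H, and the path labeled by this prefix leads in Gamma_B(H) to a vertex different
  from the base point and in Gamma_B(K) back to the base point.
*)
theory Submission
  imports Defs "HOL-Algebra.Coset"
begin

section \<open>Cancellation in products of reduced words, and cyclic reduction\<close>

section \<open>Reduced words\<close>

lemma reduced_word_successively:
  "reduced_word w \<longleftrightarrow> successively (\<lambda>x y. y \<noteq> letter_inv x) w"
  by (simp add: reduced_word_def successively_conv_nth)

lemma reduced_word_append:
  "reduced_word (u @ v) \<longleftrightarrow>
     reduced_word u \<and> reduced_word v \<and> (u = [] \<or> v = [] \<or> hd v \<noteq> letter_inv (last u))"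
  by (auto simp: reduced_word_successively successively_append_iff)

lemma reduced_word_map_apfst:
  assumes "inj_on f B" "set w \<subseteq> B \<times> UNIV"
  shows "reduced_word (map (apfst f) w) \<longleftrightarrow> reduced_word w"
proof -
  have "apfst f y \<noteq> letter_inv (apfst f x) \<longleftrightarrow> y \<noteq> letter_inv x"
    if "x \<in> set w" "y \<in> set w" for x y
  proof -
    have "fst x \<in> B" "fst y \<in> B" using that assms(2) by auto
    then show ?thesis
      using inj_on_eq_iff[OF assms(1)] by (auto simp: letter_inv_def prod_eq_iff)
  qed
  then show ?thesis
    unfolding reduced_word_successively successively_map by (intro successively_cong) auto
qed

lemma foldr_red_cons_append:
  "reduced_word (u @ v) \<Longrightarrow> foldr red_cons u v = u @ v"
  using foldr_red_cons_Nil[of "u @ v"] foldr_red_cons_Nil[of v]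
  by (simp add: reduced_word_append)

lemma mult_free_group: "u \<otimes>\<^bsub>free_group Y\<^esub> v = foldr red_cons u v"
  by (simp add: free_group_def)

lemma inv_free_group:
  assumes "w \<in> carrier (free_group Y)"
  shows "inv\<^bsub>free_group Y\<^esub> w = map letter_inv (rev w)"
proof -
  interpret group "free_group Y" by (rule group_free_group)
  show ?thesis
    using assms foldr_red_cons_inverse[of "[]" w] reduced_word_inverse[of w]
    by (intro inv_equality)
      (auto simp: free_group_def foldr_red_cons_Nil letter_inv_def)
qed

text \<open>The letters of \<open>c\<close> are multiplied onto \<open>k\<close> from the last to
  the first. As long as they cancel, each costs one letter of \<open>k\<close>; once one survives,
  its neighbour in the reduced word \<open>c\<close> cannot cancel against it, so all remaining
  letters survive as well.\<close>

lemma red_cons_product_cases: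
  assumes "reduced_word c" "reduced_word k" "c \<noteq> []"
  shows "(foldr red_cons c k \<noteq> [] \<and> hd (foldr red_cons c k) = hd c) \<or>
    length k = length c + length (foldr red_cons c k)"
  using assms(1,3)
proof (induction c)
  case (Cons x c)
  let ?r = "foldr red_cons c k"
  have step: "red_cons x ?r = x # ?r \<or> (?r \<noteq> [] \<and> hd ?r = letter_inv x \<and> red_cons x ?r = tl ?r)"
    by (cases ?r) auto
  show ?case
  proof (cases "c = []")
    case True
    then show ?thesis using step by (cases k) auto
  next
    case False
    then have c: "reduced_word c" "hd c \<noteq> letter_inv x"
      using Cons.prems by (auto simp: reduced_word_Cons)
    from Cons.IH[OF c(1) False] c(2) step show ?thesis
      by (cases ?r) auto
  qed
qed auto

text \<open>Complete cancellation of the nonempty word c or of its inverse would make the product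
  with k shorter than k. Hence ck starts with the first letter of c, and k^-1 c ends with the last
  letter of c; the condition on these two letters prevents cancellation where the words
  meet.\<close>

lemma reduced_word_conjugate_square:
  fixes Y :: "'a set"
  defines "F \<equiv> free_group Y"
  assumes c: "c \<in> carrier F" "c \<noteq> []" "hd c \<noteq> letter_inv (last c)"
    and k: "k \<in> carrier F" "length k \<le> length (c \<otimes>\<^bsub>F\<^esub> k)"
      "length k \<le> length (inv\<^bsub>F\<^esub> c \<otimes>\<^bsub>F\<^esub> k)"
  shows "reduced_word ((inv\<^bsub>F\<^esub> k \<otimes>\<^bsub>F\<^esub> c) @ (c \<otimes>\<^bsub>F\<^esub> k))"
proof -
  interpret group F unfolding F_def by (rule group_free_group)
  have red: "reduced_word w" if "w \<in> carrier F" for w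
    using that by (simp add: F_def free_group_def)
  have m: "u \<otimes>\<^bsub>F\<^esub> v = foldr red_cons u v" for u v
    by (simp add: F_def mult_free_group)
  have invw: "inv\<^bsub>F\<^esub> w = map letter_inv (rev w)" if "w \<in> carrier F" for w
    using that inv_free_group unfolding F_def by blast
  have hd_prod: "d \<otimes>\<^bsub>F\<^esub> k \<noteq> [] \<and> hd (d \<otimes>\<^bsub>F\<^esub> k) = hd d"
    if "d \<in> carrier F" "d \<noteq> []" "length k \<le> length (d \<otimes>\<^bsub>F\<^esub> k)" for d
    using red_cons_product_cases[OF red[OF that(1)] red[OF k(1)] that(2)] that(2,3)
    by (auto simp: m)
  have v: "c \<otimes>\<^bsub>F\<^esub> k \<noteq> []" "hd (c \<otimes>\<^bsub>F\<^esub> k) = hd c"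
    using hd_prod[of c] c k by auto
  let ?d = "inv\<^bsub>F\<^esub> c \<otimes>\<^bsub>F\<^esub> k"
  have d: "?d \<noteq> []" "hd ?d = letter_inv (last c)"
    using hd_prod[OF inv_closed[OF c(1)]] c k by (auto simp: invw hd_map hd_rev)
  \<comment> \<open>The last letter of k^-1 c is read off from the first letter of its inverse c^-1
    k.\<close>
  have u: "inv\<^bsub>F\<^esub> k \<otimes>\<^bsub>F\<^esub> c = map letter_inv (rev ?d)"
    using c k by (subst invw[symmetric]) (auto simp: inv_mult_group)
  have "last (inv\<^bsub>F\<^esub> k \<otimes>\<^bsub>F\<^esub> c) = last c"
    using d unfolding u by (simp add: last_map last_rev)
  then show ?thesis
    using v c k by (simp add: reduced_word_append red)
qed

text \<open>Otherwise c has the form x d x^-1, and conjugating by the letter x leaves the shorter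
  word d.\<close>

lemma cyclically_reduced_of_shortest:
  fixes Y :: "'a set"
  defines "F \<equiv> free_group Y"
  assumes c: "c \<in> carrier F" "c \<noteq> []"
    and min: "\<And>x. x \<in> carrier F \<Longrightarrow> length c \<le> length (inv\<^bsub>F\<^esub> x \<otimes>\<^bsub>F\<^esub> c \<otimes>\<^bsub>F\<^esub> x)"
  shows "hd c \<noteq> letter_inv (last c)"
proof
  assume eq: "hd c = letter_inv (last c)"
  obtain x c' where c': "c = x # c'" using c by (cases c) auto
  \<comment> \<open>A one-letter word is excluded because no letter is its own inverse.\<close>
  have "c' \<noteq> []" using eq c' by auto
  then obtain d where d: "c' = d @ [letter_inv x]"
    using eq c' by (metis append_butlast_last_id last_ConsR letter_inv_invol list.sel(1))
  have x: "[x] \<in> carrier F"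
    using c c' by (auto simp: F_def free_group_def reduced_word_def)
  have "reduced_word d"
    using c c' d by (auto simp: F_def free_group_def reduced_word_append reduced_word_Cons)
  then have "inv\<^bsub>F\<^esub> [x] \<otimes>\<^bsub>F\<^esub> c \<otimes>\<^bsub>F\<^esub> [x] = d"
    using inv_free_group[OF x[unfolded F_def]] c' d
    by (simp add: F_def free_group_def foldr_red_cons_Nil)
  with min[OF x] c' d show False by simp
qed

section \<open>Evaluation homomorphisms, and transport of a basis along an isomorphism\<close>

section \<open>Evaluation of words and change of basis\<close>

text \<open>The factor that one letter contributes to \<open>word_eval\<close>, named separately so
  that the labels along a path can be compared with the letters of a word one by one.\<close>

definition letter_val :: "('g, 'm) monoid_scheme \<Rightarrow> 'g \<times> bool \<Rightarrow> 'g" where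
  "letter_val F x = (if snd x then fst x else inv\<^bsub>F\<^esub> (fst x))"

lemma word_eval_Nil [simp]: "word_eval F [] = \<one>\<^bsub>F\<^esub>"
  by (simp add: word_eval_def)

lemma word_eval_Cons [simp]: "word_eval F (x # w) = letter_val F x \<otimes>\<^bsub>F\<^esub> word_eval F w"
  by (simp add: word_eval_def letter_val_def case_prod_unfold)

context group
begin

lemma letter_val_closed: "fst x \<in> carrier G \<Longrightarrow> letter_val G x \<in> carrier G"
  by (simp add: letter_val_def)

lemma letter_val_letter_inv:
  "fst x \<in> carrier G \<Longrightarrow> letter_val G (letter_inv x) = inv (letter_val G x)"
  by (simp add: letter_val_def letter_inv_def)

lemma word_eval_closed: "fst ` set w \<subseteq> carrier G \<Longrightarrow> word_eval G w \<in> carrier G"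
  by (induction w) (auto intro!: letter_val_closed)

lemma word_eval_red_cons:
  assumes "fst ` set (x # w) \<subseteq> carrier G"
  shows "word_eval G (red_cons x w) = letter_val G x \<otimes> word_eval G w"
proof (cases w)
  case (Cons y v)
  have "letter_val G x \<otimes> (inv letter_val G x \<otimes> word_eval G v) = word_eval G v"
    using assms Cons letter_val_closed[of x] word_eval_closed[of v]
    by (simp add: m_assoc[symmetric])
  then show ?thesis
    using assms Cons letter_val_letter_inv[of x] by auto
qed simp

text \<open>Evaluation does not notice the cancellation of a letter against its inverse. With this,
  only bijectivity remains to be proved when a set is to be recognized as a basis.\<close>

lemma word_eval_hom:
  assumes "B \<subseteq> carrier G"
  shows "word_eval G \<in> hom (free_group B) G"
proof (rule homI)
  fix u v assume u: "u \<in> carrier (free_group B)" and v: "v \<in> carrier (free_group B)"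
  have cl: "fst ` set w \<subseteq> carrier G" if "set w \<subseteq> B \<times> UNIV" for w
    using that assms by auto
  from u v have "set u \<subseteq> B \<times> UNIV" "set v \<subseteq> B \<times> UNIV"
    by (auto simp: free_group_def)
  then have "word_eval G (foldr red_cons u v) = word_eval G u \<otimes> word_eval G v"
  proof (induction u)
    case (Cons x u)
    have "set (foldr red_cons u v) \<subseteq> B \<times> UNIV"
      using Cons.prems set_foldr_red_cons[of u v] by auto
    then have "word_eval G (foldr red_cons (x # u) v) =
        letter_val G x \<otimes> word_eval G (foldr red_cons u v)"
      using Cons.prems cl[of "x # foldr red_cons u v"] by (simp add: word_eval_red_cons)
    then show ?case
      using Cons cl[of "[x]"] cl[of u] cl[of v]
      by (simp add: m_assoc letter_val_closed word_eval_closed)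
  qed (use cl[of v] in \<open>simp add: word_eval_closed\<close>)
  then show "word_eval G (u \<otimes>\<^bsub>free_group B\<^esub> v) = word_eval G u \<otimes> word_eval G v"
    by (simp add: free_group_def)
next
  fix u assume "u \<in> carrier (free_group B)"
  then show "word_eval G u \<in> carrier G"
    using assms by (intro word_eval_closed) (auto simp: free_group_def)
qed

lemma word_eval_inj:
  assumes "free_basis G B" "u \<in> carrier (free_group B)" "v \<in> carrier (free_group B)"
    and "word_eval G u = word_eval G v"
  shows "u = v"
  using assms by (auto simp: free_basis_def iso_def bij_betw_def dest: inj_onD)

lemma word_eval_surj:
  assumes "free_basis G B" "g \<in> carrier G"
  obtains w where "w \<in> carrier (free_group B)" "word_eval G w = g"
proof -
  have "g \<in> word_eval G ` carrier (free_group B)"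
    using assms by (simp add: free_basis_def iso_def bij_betw_def)
  then show thesis using that by blast
qed

text \<open>A basis element and its inverse are the values of two distinct reduced words of length
  one, and evaluation is injective on reduced words.\<close>

lemma inv_basis_label_neq:
  assumes B: "free_basis G B" and l: "l \<in> B \<union> m_inv G ` B"
  shows "inv l \<noteq> l"
proof -
  have "inv b \<noteq> b" if "b \<in> B" for b
  proof -
    have b: "b \<in> carrier G" using B that by (auto simp: free_basis_def)
    show ?thesis
      using word_eval_inj[OF B, of "[(b, True)]" "[(b, False)]"] that b
      by (auto simp: free_group_def reduced_word_def letter_val_def)
  qed
  moreover have "B \<subseteq> carrier G" using B by (auto simp: free_basis_def)
  ultimately show ?thesis using l by (auto simp: subset_iff) (metis inv_inv)
qed

lemma conj_iso:
  assumes "w \<in> carrier G"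
  shows "(\<lambda>x. w \<otimes> x \<otimes> inv w) \<in> iso G G"
proof -
  have inv_cancel: "a \<otimes> (inv a \<otimes> x) = x" "inv a \<otimes> (a \<otimes> x) = x"
    if "a \<in> carrier G" "x \<in> carrier G" for a x
    using that by (simp_all add: m_assoc[symmetric])
  then have conj_cancel: "a \<otimes> (inv a \<otimes> x \<otimes> a) \<otimes> inv a = x"
    if "a \<in> carrier G" "x \<in> carrier G" for a x
    using that by (simp add: m_assoc)
  have "bij_betw (\<lambda>x. w \<otimes> x \<otimes> inv w) (carrier G) (carrier G)"
    using assms conj_cancel[of w] conj_cancel[of "inv w"]
    by (intro bij_betwI[where g = "\<lambda>x. inv w \<otimes> x \<otimes> w"]) auto
  moreover have "w \<otimes> (x \<otimes> y) \<otimes> inv w = w \<otimes> x \<otimes> inv w \<otimes> (w \<otimes> y \<otimes> inv w)"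
    if "x \<in> carrier G" "y \<in> carrier G" for x y
    using assms that inv_cancel by (simp add: m_assoc)
  ultimately show ?thesis
    using assms by (auto simp: iso_def hom_def)
qed

end

lemma word_eval_map_hom:
  assumes "group F" "group F'" "\<alpha> \<in> hom F F'" "fst ` set w \<subseteq> carrier F"
  shows "word_eval F' (map (apfst \<alpha>) w) = \<alpha> (word_eval F w)"
proof -
  interpret group_hom F F' \<alpha> using assms by (simp add: group_hom_def group_hom_axioms_def)
  show ?thesis using assms(4)
  proof (induction w)
    case (Cons x w)
    then show ?case
      using G.letter_val_closed[of x] G.word_eval_closed[of w]
      by (simp add: letter_val_def)
  qed simp
qed

text \<open>Renaming letters by \<alpha> is a bijection between the reduced words over the two sets,
  and evaluating after renaming is the same as applying \<alpha> after evaluating. Three of the four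
  maps in this square are bijective, hence so is the fourth.\<close>

lemma free_basis_iso_image:
  assumes F: "group F" "group F'" and \<alpha>: "\<alpha> \<in> iso F F'" and B: "free_basis F B"
  shows "free_basis F' (\<alpha> ` B)"
proof -
  interpret F': group F' by fact
  have sub: "B \<subseteq> carrier F" and bij: "bij_betw \<alpha> (carrier F) (carrier F')"
    using \<alpha> B by (auto simp: free_basis_def iso_def)
  then have sub': "\<alpha> ` B \<subseteq> carrier F'" by (auto simp: bij_betw_def)
  have inj: "inj_on \<alpha> B" using sub bij by (auto simp: bij_betw_def intro: inj_on_subset)
  let ?f = "map (apfst \<alpha>)" and ?g = "map (apfst (inv_into B \<alpha>))"
  have "bij_betw ?f (carrier (free_group B)) (carrier (free_group (\<alpha> ` B)))"
  proof (rule bij_betwI[where g = ?g])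
    show "?f \<in> carrier (free_group B) \<rightarrow> carrier (free_group (\<alpha> ` B))"
      using reduced_word_map_apfst[OF inj] by (fastforce simp: free_group_def)
    show "?g \<in> carrier (free_group (\<alpha> ` B)) \<rightarrow> carrier (free_group B)"
      using reduced_word_map_apfst[OF inj_on_inv_into[of "\<alpha> ` B" \<alpha> B]]
      by (fastforce simp: free_group_def inv_into_into)
    show "?g (?f w) = w" if "w \<in> carrier (free_group B)" for w
      using that inj by (auto simp: free_group_def intro!: map_idI)
    show "?f (?g w) = w" if "w \<in> carrier (free_group (\<alpha> ` B))" for w
      using that by (fastforce simp: free_group_def f_inv_into_f intro!: map_idI)
  qed
  moreover have "bij_betw (word_eval F' \<circ> ?f) (carrier (free_group B)) (carrier F')"
  proof -
    have "word_eval F' (?f w) = \<alpha> (word_eval F w)" if "w \<in> carrier (free_group B)" for w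
      using that sub \<alpha> by (intro word_eval_map_hom F) (auto simp: iso_def free_group_def)
    moreover have "bij_betw (\<alpha> \<circ> word_eval F) (carrier (free_group B)) (carrier F')"
      using B bij by (auto simp: free_basis_def iso_def intro: bij_betw_trans)
    ultimately show ?thesis by (subst bij_betw_cong[where g = "\<alpha> \<circ> word_eval F"]) auto
  qed
  ultimately have "bij_betw (word_eval F') (carrier (free_group (\<alpha> ` B))) (carrier F')"
    using bij_betw_comp_iff by blast
  then show ?thesis
    using F'.word_eval_hom[OF sub'] sub' by (auto simp: free_basis_def iso_def)
qed

section \<open>Reduced paths in a folded graph as reduced words\<close>

section \<open>Paths in folded graphs\<close>

lemma path_append:
  "path \<Gamma> u (es @ fs) v \<longleftrightarrow> (\<exists>w. path \<Gamma> u es w \<and> path \<Gamma> w fs v)" if "serre_graph \<Gamma>"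
proof (induction es arbitrary: u)
  case Nil
  then show ?case
    using that by (cases fs) (auto simp: serre_graph_def)
qed auto

lemma path_verts:
  assumes "serre_graph \<Gamma>" "path \<Gamma> u es v"
  shows "u \<in> verts \<Gamma>" "v \<in> verts \<Gamma>"
  using assms(2)
  by (induction es arbitrary: u) (use assms(1) in \<open>auto simp: serre_graph_def\<close>)

lemma path_edges: "path \<Gamma> u es v \<Longrightarrow> set es \<subseteq> edges \<Gamma>"
  by (induction es arbitrary: u) auto

lemma path_end_unique: "path \<Gamma> u es v \<Longrightarrow> path \<Gamma> u es v' \<Longrightarrow> v = v'"
  by (induction es arbitrary: u) auto

lemma path_rev:
  assumes "serre_graph \<Gamma>" "path \<Gamma> u es v"
  shows "path \<Gamma> v (map (bar \<Gamma>) (rev es)) u"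
  using assms(2)
proof (induction es arbitrary: u)
  case (Cons e es)
  then have "path \<Gamma> (term_vert \<Gamma> e) [bar \<Gamma> e] u"
    using assms(1) by (auto simp: serre_graph_def term_vert_def)
  with Cons show ?case using assms(1) by (auto simp: path_append)
qed auto

lemma reduced_path_successively:
  "reduced_path \<Gamma> es \<longleftrightarrow> successively (\<lambda>e f. f \<noteq> bar \<Gamma> e) es"
  by (simp add: reduced_path_def successively_conv_nth)

lemma reduced_path_Cons:
  "reduced_path \<Gamma> (e # es) \<longleftrightarrow> reduced_path \<Gamma> es \<and> (es = [] \<or> hd es \<noteq> bar \<Gamma> e)"
  by (auto simp: reduced_path_successively successively_Cons)

lemma reduced_path_rev:
  assumes "serre_graph \<Gamma>" "set es \<subseteq> edges \<Gamma>" "reduced_path \<Gamma> es"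
  shows "reduced_path \<Gamma> (map (bar \<Gamma>) (rev es))"
proof -
  have "bar \<Gamma> e \<noteq> bar \<Gamma> (bar \<Gamma> f)" if "e \<in> set es" "f \<in> set es" "f \<noteq> bar \<Gamma> e" for e f
    using that assms by (auto simp: serre_graph_def subset_iff)
  then show ?thesis
    using assms(3) unfolding reduced_path_successively successively_map successively_rev
    by (auto intro: successively_mono)
qed

lemma path_label_Nil [simp]: "path_label F \<Gamma> [] = \<one>\<^bsub>F\<^esub>"
  by (simp add: path_label_def)

lemma path_label_Cons [simp]:
  "path_label F \<Gamma> (e # es) = lab \<Gamma> e \<otimes>\<^bsub>F\<^esub> path_label F \<Gamma> es"
  by (simp add: path_label_def)

lemma path_label_eq_word_eval:
  "map (lab \<Gamma>) es = map (letter_val F) w \<Longrightarrow> path_label F \<Gamma> es = word_eval F w"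
  by (induction es arbitrary: w) auto

text \<open>A folded graph acts as a deterministic automaton: the current vertex and the next label
  leave at most one choice for the next edge.\<close>

lemma folded_path_unique:
  assumes "folded \<Gamma>" "path \<Gamma> u es v" "path \<Gamma> u fs v'" "map (lab \<Gamma>) es = map (lab \<Gamma>) fs"
  shows "es = fs"
  using assms(2-)
proof (induction es arbitrary: u fs)
  case (Cons e es)
  then obtain f fs' where fs: "fs = f # fs'" by (cases fs) auto
  then have "e \<in> edges \<Gamma>" "f \<in> edges \<Gamma>" "init \<Gamma> e = init \<Gamma> f" "lab \<Gamma> e = lab \<Gamma> f"
    using Cons.prems by auto
  then have "e = f"
    using assms(1) unfolding folded_def by blast
  with Cons fs show ?case by auto
qed auto

context group
begin

lemma lab_closed:
  assumes "pointed_labeled_graph G B \<Gamma>" "B \<subseteq> carrier G" "e \<in> edges \<Gamma>"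
  shows "lab \<Gamma> e \<in> carrier G"
proof -
  have "lab \<Gamma> e \<in> B \<union> m_inv G ` B" using assms(1,3) by (simp add: pointed_labeled_graph_def)
  then show ?thesis using assms(2) by auto
qed

lemma path_label_closed:
  assumes "pointed_labeled_graph G B \<Gamma>" "B \<subseteq> carrier G" "set es \<subseteq> edges \<Gamma>"
  shows "path_label G \<Gamma> es \<in> carrier G"
  using assms(3) by (induction es) (use lab_closed[OF assms(1,2)] in auto)

text \<open>Putting an edge in front of a reduced path can create a backtrack only at the front.
  Deleting that pair of edges keeps the label, since an edge and its inverse have inverse
  labels.\<close>

lemma path_reduce:
  assumes \<Gamma>: "pointed_labeled_graph G B \<Gamma>" "B \<subseteq> carrier G" and "path \<Gamma> u es v"
  shows "\<exists>fs. path \<Gamma> u fs v \<and> reduced_path \<Gamma> fs \<and> path_label G \<Gamma> fs = path_label G \<Gamma> es"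
  using assms(3)
proof (induction es arbitrary: u)
  case Nil
  then show ?case by (intro exI[of _ "[]"]) (auto simp: reduced_path_def)
next
  case (Cons e es)
  then have e: "e \<in> edges \<Gamma>" "init \<Gamma> e = u" by auto
  obtain fs where fs: "path \<Gamma> (term_vert \<Gamma> e) fs v" "reduced_path \<Gamma> fs"
    "path_label G \<Gamma> fs = path_label G \<Gamma> es"
    using Cons by auto
  show ?case
  proof (cases "fs \<noteq> [] \<and> hd fs = bar \<Gamma> e")
    case True
    then obtain gs where gs: "fs = bar \<Gamma> e # gs" by (cases fs) auto
    have "bar \<Gamma> (bar \<Gamma> e) = e" "lab \<Gamma> (bar \<Gamma> e) = inv (lab \<Gamma> e)"
      using \<Gamma> e by (auto simp: pointed_labeled_graph_def serre_graph_def)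
    moreover have "path_label G \<Gamma> gs \<in> carrier G" "lab \<Gamma> e \<in> carrier G"
      using path_edges[OF fs(1)] e gs
      by (auto intro: path_label_closed[OF \<Gamma>] lab_closed[OF \<Gamma>])
    ultimately have "path_label G \<Gamma> gs = lab \<Gamma> e \<otimes> path_label G \<Gamma> fs"
      unfolding gs by (simp add: m_assoc[symmetric])
    moreover have "path \<Gamma> u gs v" "reduced_path \<Gamma> gs"
      using fs(1,2) e \<open>bar \<Gamma> (bar \<Gamma> e) = e\<close> unfolding gs
      by (auto simp: term_vert_def reduced_path_Cons)
    ultimately show ?thesis using fs(3) by auto
  next
    case False
    then show ?thesis
      using fs e by (intro exI[of _ "e # fs"]) (auto simp: reduced_path_Cons)
  qed
qed

text \<open>Adjacent labels of a reduced path do not cancel: if the edge f after e carried the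
  inverse of the label of e, then f and \<open>bar \<Gamma> e\<close> would start at the same vertex
  with the same label and coincide by foldedness.\<close>

lemma reduced_path_word:
  assumes \<Gamma>: "pointed_labeled_graph G B \<Gamma>" "folded \<Gamma>" "B \<subseteq> carrier G"
    and "path \<Gamma> u es v" "reduced_path \<Gamma> es"
  shows "\<exists>w \<in> carrier (free_group B). map (lab \<Gamma>) es = map (letter_val G) w"
  using assms(4,5)
proof (induction es arbitrary: u)
  case Nil
  then show ?case by (auto simp: free_group_def)
next
  case (Cons e es)
  then have e: "e \<in> edges \<Gamma>" "bar \<Gamma> e \<in> edges \<Gamma>" "lab \<Gamma> (bar \<Gamma> e) = inv (lab \<Gamma> e)"
    using \<Gamma> by (auto simp: pointed_labeled_graph_def serre_graph_def)
  obtain w where w: "w \<in> carrier (free_group B)" "map (lab \<Gamma>) es = map (letter_val G) w"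
    using Cons by (auto simp: reduced_path_Cons)
  have "lab \<Gamma> e \<in> B \<union> m_inv G ` B"
    using \<Gamma> e by (auto simp: pointed_labeled_graph_def)
  then obtain x where x: "fst x \<in> B" "lab \<Gamma> e = letter_val G x"
    by (auto simp: letter_val_def intro: that[of "(_, True)"] that[of "(_, False)"])
  have "hd w \<noteq> letter_inv x" if "w \<noteq> []"
  proof
    assume "hd w = letter_inv x"
    with that w x obtain f fs where f: "es = f # fs" "lab \<Gamma> f = letter_val G (letter_inv x)"
      by (cases es; cases w) auto
    have "lab \<Gamma> f = lab \<Gamma> (bar \<Gamma> e)"
      using f x e \<Gamma>(3) by (auto simp: letter_val_letter_inv)
    moreover have "f \<in> edges \<Gamma>" "init \<Gamma> f = init \<Gamma> (bar \<Gamma> e)" "f \<noteq> bar \<Gamma> e"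
      using Cons.prems f by (auto simp: term_vert_def reduced_path_Cons)
    ultimately show False using \<Gamma>(2) e unfolding folded_def by blast
  qed
  then have "x # w \<in> carrier (free_group B)"
    using w x by (cases x) (auto simp: free_group_def reduced_word_Cons)
  then show ?case using w x by (intro bexI[of _ "x # w"]) auto
qed

text \<open>Reducing a closed path with the right label gives a path that spells some reduced word
  with the same value, and over a basis this word must be \<open>w\<close>. Reading \<open>w\<close>
  letter by letter along a path gives access to its prefixes.\<close>

lemma pi1_reduced_word:
  assumes \<Gamma>: "pointed_labeled_graph G B \<Gamma>" "folded \<Gamma>" and B: "free_basis G B"
    and w: "w \<in> carrier (free_group B)" "word_eval G w \<in> pi1 G \<Gamma>"
  obtains es where "path \<Gamma> (base \<Gamma>) es (base \<Gamma>)" "reduced_path \<Gamma> es"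
    "map (lab \<Gamma>) es = map (letter_val G) w"
proof -
  have sub: "B \<subseteq> carrier G" using B by (simp add: free_basis_def)
  obtain es where es: "path \<Gamma> (base \<Gamma>) es (base \<Gamma>)" "reduced_path \<Gamma> es"
    "path_label G \<Gamma> es = word_eval G w"
    using w(2) path_reduce[OF \<Gamma>(1) sub] by (fastforce simp: pi1_def)
  obtain w' where w': "w' \<in> carrier (free_group B)" "map (lab \<Gamma>) es = map (letter_val G) w'"
    using reduced_path_word[OF \<Gamma> sub es(1,2)] by auto
  have "w' = w"
    using word_eval_inj[OF B w'(1) w(1)] path_label_eq_word_eval[OF w'(2)] es(3) by simp
  with that es w' show ?thesis by blast
qed

end

section \<open>Action of morphisms on paths, and a criterion for non-injectivity\<close>

section \<open>Morphisms\<close>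

lemma pl_morphism_path:
  assumes "pl_morphism \<Gamma> \<Delta> \<phi>" "serre_graph \<Gamma>" "path \<Gamma> u es v"
  shows "path \<Delta> (fst \<phi> u) (map (snd \<phi>) es) (fst \<phi> v)"
    and "map (lab \<Delta>) (map (snd \<phi>) es) = map (lab \<Gamma>) es"
  using assms(3)
proof (induction es arbitrary: u)
  case Nil
  case 1
  then show ?case using assms(1) by (auto simp: pl_morphism_def)
next
  case (Cons e es)
  have e: "snd \<phi> e \<in> edges \<Delta>" "init \<Delta> (snd \<phi> e) = fst \<phi> (init \<Gamma> e)"
    "term_vert \<Delta> (snd \<phi> e) = fst \<phi> (term_vert \<Gamma> e)" "lab \<Delta> (snd \<phi> e) = lab \<Gamma> e"
    if "e \<in> edges \<Gamma>"
    using that assms(1,2) by (auto simp: pl_morphism_def term_vert_def serre_graph_def)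
  case 1
  then show ?case using Cons e by auto
  case 2
  then show ?case using Cons e by auto
qed auto

text \<open>A backtrack could arise only if an edge and the inverse of its predecessor had the same
  image. As labels are preserved, both would carry the same label at the same vertex of the folded
  graph \<Gamma> and would already be equal.\<close>

lemma pl_morphism_reduced_path:
  assumes \<phi>: "pl_morphism \<Gamma> \<Delta> \<phi>" and \<Gamma>: "serre_graph \<Gamma>" "folded \<Gamma>"
    and "path \<Gamma> u es v" "reduced_path \<Gamma> es"
  shows "reduced_path \<Delta> (map (snd \<phi>) es)"
  using assms(4,5)
proof (induction es arbitrary: u)
  case (Cons e es)
  have "snd \<phi> (hd es) \<noteq> bar \<Delta> (snd \<phi> e)" if "es \<noteq> []"
  proof
    assume eq: "snd \<phi> (hd es) = bar \<Delta> (snd \<phi> e)"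
    obtain f fs where f: "es = f # fs" using \<open>es \<noteq> []\<close> by (cases es) auto
    have ef: "e \<in> edges \<Gamma>" "bar \<Gamma> e \<in> edges \<Gamma>" "f \<in> edges \<Gamma>" "init \<Gamma> f = init \<Gamma> (bar \<Gamma> e)"
      "f \<noteq> bar \<Gamma> e"
      using Cons.prems f \<Gamma>(1) by (auto simp: term_vert_def reduced_path_Cons serre_graph_def)
    have "bar \<Delta> (snd \<phi> e) = snd \<phi> (bar \<Gamma> e)" "lab \<Delta> (snd \<phi> f) = lab \<Gamma> f"
      "lab \<Delta> (snd \<phi> (bar \<Gamma> e)) = lab \<Gamma> (bar \<Gamma> e)"
      using \<phi> ef by (auto simp: pl_morphism_def)
    then have "lab \<Gamma> f = lab \<Gamma> (bar \<Gamma> e)" using eq f by simp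
    then show False using ef \<Gamma>(2) unfolding folded_def by blast
  qed
  then show ?case
    using Cons by (auto simp: reduced_path_Cons hd_map)
qed (simp add: reduced_path_def)

text \<open>The prefix \<open>u\<close> of a reduced word for an element of \<open>H\<close> labels
  a path in \<Gamma> from the base point to some vertex p, and in \<Delta> it labels a closed path
  at the base point. The first path is mapped to the second, so p and the base point have the same
  image; they differ because \<open>u\<close> does not represent an element of
  \<open>H\<close>.\<close>

lemma (in group) not_injective_morphism_if_prefix:
  assumes B: "free_basis G B"
    and \<Gamma>: "is_core_graph_of G B H \<Gamma>" and \<Delta>: "is_core_graph_of G B K \<Delta>"
    and \<phi>: "pl_morphism \<Gamma> \<Delta> \<phi>"
    and w: "u @ v \<in> carrier (free_group B)" "word_eval G (u @ v) \<in> H"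
    and u: "word_eval G u \<in> K" "word_eval G u \<notin> H"
  shows "\<not> injective_morphism \<Gamma> \<phi>"
proof
  assume inj: "injective_morphism \<Gamma> \<phi>"
  have g: "pointed_labeled_graph G B \<Gamma>" "folded \<Gamma>" "serre_graph \<Gamma>" "pi1 G \<Gamma> = H"
    and d: "pointed_labeled_graph G B \<Delta>" "folded \<Delta>" "pi1 G \<Delta> = K"
    using \<Gamma> \<Delta> by (auto simp: is_core_graph_of_def core_graph_def pointed_labeled_graph_def)
  obtain es where es: "path \<Gamma> (base \<Gamma>) es (base \<Gamma>)" "reduced_path \<Gamma> es"
    "map (lab \<Gamma>) es = map (letter_val G) (u @ v)"
    using pi1_reduced_word[OF g(1,2) B w(1)] w(2) g(4) by metis
  obtain es1 es2 where split: "es = es1 @ es2" "map (lab \<Gamma>) es1 = map (letter_val G) u"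
    using es(3) unfolding map_append by (auto simp: map_eq_append_conv)
  obtain p where p: "path \<Gamma> (base \<Gamma>) es1 p"
    using es(1) split(1) g(3) by (auto simp: path_append)
  have "u \<in> carrier (free_group B)"
    using w(1) by (auto simp: free_group_def reduced_word_append)
  then obtain fs where fs: "path \<Delta> (base \<Delta>) fs (base \<Delta>)" "map (lab \<Delta>) fs = map (letter_val G) u"
    using pi1_reduced_word[OF d(1,2) B] u(1) d(3) by metis
  note im = pl_morphism_path[OF \<phi> g(3) p]
  have base: "fst \<phi> (base \<Gamma>) = base \<Delta>" using \<phi> by (simp add: pl_morphism_def)
  have "map (snd \<phi>) es1 = fs"
    using folded_path_unique[OF d(2) im(1)[unfolded base] fs(1)] im(2) fs(2) split(2) by simp
  then have "fst \<phi> p = fst \<phi> (base \<Gamma>)"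
    using path_end_unique im(1) fs(1) base by metis
  then have "p = base \<Gamma>"
    using inj path_verts[OF g(3) p] by (auto simp: injective_morphism_def dest: inj_onD)
  then have "word_eval G u \<in> H"
    using p path_label_eq_word_eval[OF split(2)] g(4) unfolding pi1_def by force
  with u(2) show False by simp
qed

section \<open>Cores of Schreier coset graphs\<close>

section \<open>Existence of core graphs\<close>

definition core_edges :: "('v, 'e, 'g) pl_graph \<Rightarrow> 'e set" where
  "core_edges \<Gamma> = {e. \<exists>es. path \<Gamma> (base \<Gamma>) es (base \<Gamma>) \<and> reduced_path \<Gamma> es \<and> e \<in> set es}"

text \<open>The base point is added separately because the core may have no edges. For the other
  vertices initial vertices suffice, as the set of core edges is closed under inversion.\<close>

definition core_of :: "('v, 'e, 'g) pl_graph \<Rightarrow> ('v, 'e, 'g) pl_graph" where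
  "core_of \<Gamma> = \<Gamma>\<lparr>verts := insert (base \<Gamma>) (init \<Gamma> ` core_edges \<Gamma>), edges := core_edges \<Gamma>\<rparr>"

lemma core_of_simps [simp]:
  "verts (core_of \<Gamma>) = insert (base \<Gamma>) (init \<Gamma> ` core_edges \<Gamma>)"
  "edges (core_of \<Gamma>) = core_edges \<Gamma>"
  "init (core_of \<Gamma>) = init \<Gamma>" "bar (core_of \<Gamma>) = bar \<Gamma>" "lab (core_of \<Gamma>) = lab \<Gamma>"
  "base (core_of \<Gamma>) = base \<Gamma>" "term_vert (core_of \<Gamma>) = term_vert \<Gamma>"
  "reduced_path (core_of \<Gamma>) = reduced_path \<Gamma>" "path_label F (core_of \<Gamma>) = path_label F \<Gamma>"
  by (auto simp: core_of_def term_vert_def reduced_path_def path_label_def fun_eq_iff)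

lemma core_edges_subset: "core_edges \<Gamma> \<subseteq> edges \<Gamma>"
  using path_edges by (fastforce simp: core_edges_def)

lemma bar_core_edges:
  assumes "serre_graph \<Gamma>" "e \<in> core_edges \<Gamma>"
  shows "bar \<Gamma> e \<in> core_edges \<Gamma>"
proof -
  obtain es where es: "path \<Gamma> (base \<Gamma>) es (base \<Gamma>)" "reduced_path \<Gamma> es" "e \<in> set es"
    using assms(2) by (auto simp: core_edges_def)
  show ?thesis
    using path_rev[OF assms(1) es(1)] reduced_path_rev[OF assms(1) path_edges[OF es(1)] es(2)] es(3)
    unfolding core_edges_def by fastforce
qed

lemma path_core_of:
  assumes \<Gamma>: "serre_graph \<Gamma>" and "path \<Gamma> u es v" "set es \<subseteq> core_edges \<Gamma>" "u \<in> verts (core_of \<Gamma>)"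
  shows "path (core_of \<Gamma>) u es v"
  using assms(2-)
proof (induction es arbitrary: u)
  case (Cons e es)
  then have "term_vert \<Gamma> e \<in> verts (core_of \<Gamma>)"
    using bar_core_edges[OF \<Gamma>] by (auto simp: term_vert_def)
  with Cons show ?case by auto
qed auto

lemma path_of_core_of:
  assumes \<Gamma>: "serre_graph \<Gamma>" "base \<Gamma> \<in> verts \<Gamma>" and "path (core_of \<Gamma>) u es v"
  shows "path \<Gamma> u es v"
  using assms(3)
proof (induction es arbitrary: u)
  case Nil
  then show ?case
    using \<Gamma> core_edges_subset[of \<Gamma>] by (auto simp: serre_graph_def)
next
  case (Cons e es)
  then show ?case using core_edges_subset[of \<Gamma>] by auto
qed

lemma reduced_closed_path_core_of:
  assumes "serre_graph \<Gamma>" "path \<Gamma> (base \<Gamma>) es (base \<Gamma>)" "reduced_path \<Gamma> es"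
  shows "path (core_of \<Gamma>) (base \<Gamma>) es (base \<Gamma>)"
  using assms by (intro path_core_of) (auto simp: core_edges_def)

lemma serre_graph_core_of: "serre_graph \<Gamma> \<Longrightarrow> serre_graph (core_of \<Gamma>)"
  using core_edges_subset[of \<Gamma>] bar_core_edges[of \<Gamma>] by (auto simp: serre_graph_def)

text \<open>A closed reduced path at the base point consists of core edges, so an initial segment of
  such a path joins the base point to any given vertex within the core.\<close>

lemma connected_graph_core_of:
  assumes \<Gamma>: "serre_graph \<Gamma>"
  shows "connected_graph (core_of \<Gamma>)"
proof -
  let ?C = "core_of \<Gamma>"
  note C = serre_graph_core_of[OF \<Gamma>]
  have from_base: "\<exists>es. path ?C (base \<Gamma>) es v" if "v \<in> verts ?C" for v
  proof (cases "v = base \<Gamma>")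
    case True
    then show ?thesis by (intro exI[of _ "[]"]) simp
  next
    case False
    with that obtain e where e: "e \<in> core_edges \<Gamma>" "v = init \<Gamma> e" by auto
    then obtain es where es: "path \<Gamma> (base \<Gamma>) es (base \<Gamma>)" "reduced_path \<Gamma> es" "e \<in> set es"
      by (auto simp: core_edges_def)
    obtain es1 es2 where "es = es1 @ e # es2" using es(3) by (auto simp: in_set_conv_decomp)
    then show ?thesis
      using reduced_closed_path_core_of[OF \<Gamma> es(1,2)] e C by (auto simp: path_append)
  qed
  show ?thesis
    unfolding connected_graph_def
  proof (intro ballI)
    fix u v assume uv: "u \<in> verts ?C" "v \<in> verts ?C"
    obtain es fs where "path ?C (base \<Gamma>) es u" "path ?C (base \<Gamma>) fs v"
      using from_base uv by meson
    then have "path ?C u (map (bar ?C) (rev es) @ fs) v"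
      using path_rev[OF C] path_append[OF C] by blast
    then show "\<exists>es. path ?C u es v" by blast
  qed
qed

text \<open>Passing to the core loses no element of \<open>pi1\<close>: a closed path at the base
  point can be reduced without changing its label, and the reduced path runs inside the
  core.\<close>

lemma (in group) is_core_graph_of_core_of:
  assumes \<Gamma>: "pointed_labeled_graph G B \<Gamma>" "folded \<Gamma>" and B: "B \<subseteq> carrier G"
  shows "is_core_graph_of G B (pi1 G \<Gamma>) (core_of \<Gamma>)"
proof -
  have s: "serre_graph \<Gamma>" "base \<Gamma> \<in> verts \<Gamma>"
    using \<Gamma> by (auto simp: pointed_labeled_graph_def)
  have "pi1 G (core_of \<Gamma>) = pi1 G \<Gamma>"
  proof
    show "pi1 G (core_of \<Gamma>) \<subseteq> pi1 G \<Gamma>"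
      using path_of_core_of[OF s] by (auto simp: pi1_def)
    show "pi1 G \<Gamma> \<subseteq> pi1 G (core_of \<Gamma>)"
    proof
      fix g assume "g \<in> pi1 G \<Gamma>"
      then obtain es where "path \<Gamma> (base \<Gamma>) es (base \<Gamma>)" "g = path_label G \<Gamma> es"
        by (auto simp: pi1_def)
      then obtain fs where "path \<Gamma> (base \<Gamma>) fs (base \<Gamma>)" "reduced_path \<Gamma> fs" "g = path_label G \<Gamma> fs"
        using path_reduce[OF \<Gamma>(1) B] by metis
      then show "g \<in> pi1 G (core_of \<Gamma>)"
        using reduced_closed_path_core_of[OF s(1)] by (auto simp: pi1_def)
    qed
  qed
  moreover have "pointed_labeled_graph G B (core_of \<Gamma>)"
    using \<Gamma>(1) serre_graph_core_of[OF s(1)] core_edges_subset[of \<Gamma>]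
    by (auto simp: pointed_labeled_graph_def)
  moreover have "folded (core_of \<Gamma>)"
    using \<Gamma>(2) core_edges_subset[of \<Gamma>] unfolding folded_def by (simp add: subset_iff)
  moreover have "\<exists>es. path (core_of \<Gamma>) (base \<Gamma>) es (base \<Gamma>) \<and> reduced_path \<Gamma> es \<and> e \<in> set es"
    if "e \<in> core_edges \<Gamma>" for e
    using that reduced_closed_path_core_of[OF s(1)] unfolding core_edges_def by blast
  ultimately show ?thesis
    using connected_graph_core_of[OF s(1)] by (simp add: is_core_graph_of_def core_graph_def)
qed

text \<open>Foldedness of \<Gamma> makes the images of closed reduced paths reduced again, so core
  edges go to core edges.\<close>

lemma pl_morphism_core_of:
  assumes \<phi>: "pl_morphism \<Gamma> \<Delta> \<phi>" and \<Gamma>: "serre_graph \<Gamma>" "folded \<Gamma>"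
  shows "pl_morphism (core_of \<Gamma>) (core_of \<Delta>) \<phi>"
proof -
  have base: "fst \<phi> (base \<Gamma>) = base \<Delta>" using \<phi> by (simp add: pl_morphism_def)
  have "snd \<phi> e \<in> core_edges \<Delta>" if "e \<in> core_edges \<Gamma>" for e
  proof -
    obtain es where es: "path \<Gamma> (base \<Gamma>) es (base \<Gamma>)" "reduced_path \<Gamma> es" "e \<in> set es"
      using \<open>e \<in> core_edges \<Gamma>\<close> unfolding core_edges_def by blast
    show ?thesis
      using pl_morphism_path(1)[OF \<phi> \<Gamma>(1) es(1)] pl_morphism_reduced_path[OF \<phi> \<Gamma> es(1,2)] es(3)
      unfolding core_edges_def base by fastforce
  qed
  moreover have "init \<Delta> (snd \<phi> e) = fst \<phi> (init \<Gamma> e)" if "e \<in> core_edges \<Gamma>" for e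
    using \<phi> that core_edges_subset[of \<Gamma>] by (auto simp: pl_morphism_def)
  ultimately show ?thesis
    using \<phi> core_edges_subset[of \<Gamma>]
    by (auto simp: pl_morphism_def subset_iff image_iff) metis+
qed

text \<open>The edge (C, l) leads from the right coset C to the coset Cl. Taking an edge to be its
  initial vertex together with its label makes foldedness immediate. The core of this graph serves
  as \<open>\<Gamma>\<^sub>B(H)\<close>.\<close>

definition schreier_graph ::
  "('g, 'm) monoid_scheme \<Rightarrow> 'g set \<Rightarrow> 'g set \<Rightarrow> ('g set, 'g set \<times> 'g, 'g) pl_graph" where
  "schreier_graph F B H = \<lparr>verts = rcosets\<^bsub>F\<^esub> H,
     edges = (rcosets\<^bsub>F\<^esub> H) \<times> (B \<union> m_inv F ` B),
     init = fst,
     bar = (\<lambda>(C, l). (C #>\<^bsub>F\<^esub> l, inv\<^bsub>F\<^esub> l)),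
     lab = snd,
     base = H\<rparr>"

lemma schreier_graph_simps [simp]:
  "verts (schreier_graph F B H) = rcosets\<^bsub>F\<^esub> H"
  "edges (schreier_graph F B H) = (rcosets\<^bsub>F\<^esub> H) \<times> (B \<union> m_inv F ` B)"
  "init (schreier_graph F B H) = fst"
  "bar (schreier_graph F B H) = (\<lambda>(C, l). (C #>\<^bsub>F\<^esub> l, inv\<^bsub>F\<^esub> l))"
  "lab (schreier_graph F B H) = snd"
  "base (schreier_graph F B H) = H"
  "term_vert (schreier_graph F B H) (C, l) = C #>\<^bsub>F\<^esub> l"
  by (auto simp: schreier_graph_def term_vert_def)

lemma folded_schreier_graph: "folded (schreier_graph F B H)"
  by (auto simp: folded_def)

context group
begin

lemma rcoset_mult_closed:
  assumes "subgroup H G" "C \<in> rcosets H" "g \<in> carrier G"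
  shows "C #> g \<in> rcosets H"
  using assms subgroup.subset[OF assms(1)]
  by (auto simp: RCOSETS_def coset_mult_assoc intro!: bexI[of _ "_ \<otimes> _"])

text \<open>For a loop, where Cl = C, the edge differs from its inverse by the label alone; this is
  where freeness of the basis enters.\<close>

lemma pointed_labeled_schreier_graph:
  assumes B: "free_basis G B" and H: "subgroup H G"
  shows "pointed_labeled_graph G B (schreier_graph G B H)"
proof -
  have sub: "B \<subseteq> carrier G" using B by (simp add: free_basis_def)
  have lab: "l \<in> carrier G" "inv l \<in> B \<union> m_inv G ` B" "inv l \<noteq> l" if "l \<in> B \<union> m_inv G ` B" for l
    using that sub inv_basis_label_neq[OF B that] by auto
  have C: "C #> l \<in> rcosets H" "C #> l #> inv l = C"
    if "C \<in> rcosets H" "l \<in> carrier G" for C l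
    using that rcoset_mult_closed[OF H that] subgroup.rcosets_carrier[OF H is_group that(1)]
    by (auto simp: coset_mult_assoc)
  have "H \<in> rcosets H" using subgroup.subgroup_in_rcosets[OF H is_group] .
  then show ?thesis
    unfolding pointed_labeled_graph_def serre_graph_def
    using lab C by (auto simp: term_vert_def)
qed

lemma schreier_graph_path_end:
  assumes B: "free_basis G B" and H: "subgroup H G"
    and "path (schreier_graph G B H) C es D" "C \<in> rcosets H"
  shows "D = C #> path_label G (schreier_graph G B H) es"
  using assms(3,4)
proof (induction es arbitrary: C)
  case Nil
  then show ?case using subgroup.rcosets_carrier[OF H is_group] by (simp add: coset_mult_one)
next
  case (Cons e es)
  let ?\<Gamma> = "schreier_graph G B H"
  have sub: "B \<subseteq> carrier G" using B by (simp add: free_basis_def)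
  obtain l where e: "e = (C, l)" using Cons.prems(1) by (cases e) auto
  with Cons.prems sub have l: "l \<in> carrier G" by auto
  have "path_label G ?\<Gamma> es \<in> carrier G"
    using path_label_closed[OF pointed_labeled_schreier_graph[OF B H] sub] Cons.prems(1) path_edges
    by (metis path.simps(2))
  moreover have "D = C #> l #> path_label G ?\<Gamma> es"
    using Cons e l rcoset_mult_closed[OF H] by auto
  ultimately show ?case
    using e l subgroup.rcosets_carrier[OF H is_group Cons.prems(2)]
    by (simp add: coset_mult_assoc)
qed

lemma schreier_graph_path_exists:
  assumes B: "B \<subseteq> carrier G" and H: "subgroup H G"
    and "set w \<subseteq> B \<times> UNIV" "C \<in> rcosets H"
  shows "\<exists>es. path (schreier_graph G B H) C es (C #> word_eval G w) \<and>
    path_label G (schreier_graph G B H) es = word_eval G w"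
  using assms(3,4)
proof (induction w arbitrary: C)
  case Nil
  then show ?case
    using subgroup.rcosets_carrier[OF H is_group] by (intro exI[of _ "[]"]) (simp add: coset_mult_one)
next
  case (Cons x w)
  have x: "letter_val G x \<in> B \<union> m_inv G ` B" using Cons.prems by (auto simp: letter_val_def)
  have xc: "letter_val G x \<in> carrier G" using x B by auto
  have wc: "word_eval G w \<in> carrier G" using Cons.prems B by (intro word_eval_closed) auto
  obtain es where "path (schreier_graph G B H) (C #> letter_val G x) es
      (C #> letter_val G x #> word_eval G w)"
    "path_label G (schreier_graph G B H) es = word_eval G w"
    using Cons.IH[of "C #> letter_val G x"] Cons.prems rcoset_mult_closed[OF H _ xc] by auto
  then show ?case
    using x xc wc Cons.prems subgroup.rcosets_carrier[OF H is_group]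
    by (intro exI[of _ "(C, letter_val G x) # es"]) (auto simp: coset_mult_assoc)
qed

text \<open>A path from H with label g ends at Hg, and Hg = H exactly when g lies in H. Conversely,
  every element of H is the value of a word, and every word can be read along a path starting at
  H.\<close>

lemma pi1_schreier_graph:
  assumes B: "free_basis G B" and H: "subgroup H G"
  shows "pi1 G (schreier_graph G B H) = H"
proof
  have sub: "B \<subseteq> carrier G" using B by (simp add: free_basis_def)
  have HH: "H \<in> rcosets H" using subgroup.subgroup_in_rcosets[OF H is_group] .
  let ?\<Gamma> = "schreier_graph G B H"
  show "pi1 G ?\<Gamma> \<subseteq> H"
  proof
    fix g assume "g \<in> pi1 G ?\<Gamma>"
    then obtain es where es: "path ?\<Gamma> H es H" "g = path_label G ?\<Gamma> es"
      by (auto simp: pi1_def)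
    have "g \<in> carrier G"
      using path_label_closed[OF pointed_labeled_schreier_graph[OF B H] sub] path_edges es by metis
    moreover have "H #> g = H"
      using schreier_graph_path_end[OF B H es(1) HH] es(2) by simp
    ultimately show "g \<in> H" using coset_join1 H by blast
  qed
  show "H \<subseteq> pi1 G ?\<Gamma>"
  proof
    fix h assume h: "h \<in> H"
    then have hc: "h \<in> carrier G" using subgroup.subset[OF H] by auto
    obtain w where w: "w \<in> carrier (free_group B)" "word_eval G w = h"
      using word_eval_surj[OF B hc] .
    have "H #> h = H" using coset_join2[OF hc H h] .
    then obtain es where "path ?\<Gamma> H es H" "path_label G ?\<Gamma> es = h"
      using schreier_graph_path_exists[OF sub H _ HH, of w] w by (auto simp: free_group_def)
    then show "h \<in> pi1 G ?\<Gamma>" unfolding pi1_def by force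
  qed
qed

text \<open>The map sends Hg to Kg. It is written as the product of \<open>K\<close> with the coset
  so that no representative has to be chosen; KH = K gives the right value.\<close>

lemma pl_morphism_schreier_graph:
  assumes B: "B \<subseteq> carrier G" and H: "subgroup H G" and K: "subgroup K G" and HK: "H \<subseteq> K"
  shows "pl_morphism (schreier_graph G B H) (schreier_graph G B K)
    (\<lambda>C. K <#> C, \<lambda>(C, l). (K <#> C, l))"
proof -
  note Hc = subgroup.subset[OF H] and Kc = subgroup.subset[OF K]
  have KH: "K <#> H = K"
  proof
    show "K <#> H \<subseteq> K" using HK subgroup.m_closed[OF K] by (auto simp: set_mult_def)
    show "K \<subseteq> K <#> H"
      using Kc subgroup.one_closed[OF H] by (force simp: set_mult_def)
  qed
  have "K <#> C \<in> rcosets K" if "C \<in> rcosets H" for C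
    using that Hc Kc KH by (auto simp: RCOSETS_def setmult_rcos_assoc)
  moreover have "K <#> C #> l = K <#> (C #> l)" if "C \<in> rcosets H" "l \<in> carrier G" for C l
    using setmult_rcos_assoc[OF Kc subgroup.rcosets_carrier[OF H is_group that(1)] that(2)] by simp
  ultimately show ?thesis
    using B KH by (auto simp: pl_morphism_def)
qed

text \<open>Supplies actual graphs and a morphism, so that a statement about all representatives is
  not vacuous.\<close>

lemma core_graph_morphism_exists:
  assumes B: "free_basis G B" and H: "subgroup H G" and K: "subgroup K G" and HK: "H \<subseteq> K"
  shows "\<exists>(\<Gamma> :: ('a set, 'a set \<times> 'a, 'a) pl_graph) (\<Delta> :: ('a set, 'a set \<times> 'a, 'a) pl_graph) \<phi>.
    is_core_graph_of G B H \<Gamma> \<and> is_core_graph_of G B K \<Delta> \<and> pl_morphism \<Gamma> \<Delta> \<phi>"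
proof -
  have sub: "B \<subseteq> carrier G" using B by (simp add: free_basis_def)
  have core: "is_core_graph_of G B L (core_of (schreier_graph G B L))" if "subgroup L G" for L
    using is_core_graph_of_core_of[OF pointed_labeled_schreier_graph[OF B that]
        folded_schreier_graph sub] pi1_schreier_graph[OF B that] by simp
  have "serre_graph (schreier_graph G B H)"
    using pointed_labeled_schreier_graph[OF B H] by (simp add: pointed_labeled_graph_def)
  then show ?thesis
    using core[OF H] core[OF K] folded_schreier_graph
      pl_morphism_core_of[OF pl_morphism_schreier_graph[OF sub H K HK]] by blast
qed

end

section \<open>Choice of the conjugator and of the conjugated basis\<close>

section \<open>The basis\<close>

text \<open>Replacing each letter y of a word x by w y w^-1 gives a word with value w x w^-1. Thus,
  read in the basis conjugated by \<open>w\<close>, the reduced word \<open>u @ v\<close> represents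
  an element of \<open>H\<close> and its prefix \<open>u\<close> an element of
  \<open>K - H\<close>.\<close>

lemma exists_conjugator_with_prefix:
  fixes Y :: "'a set"
  defines "F \<equiv> free_group Y"
  assumes H: "subgroup H F" and K: "subgroup K F" and HK: "H \<subset> K" and H1: "H \<noteq> {\<one>\<^bsub>F\<^esub>}"
  obtains w u v where "w \<in> carrier F" "u \<in> carrier F" "v \<in> carrier F" "reduced_word (u @ v)"
    "w \<otimes>\<^bsub>F\<^esub> (u @ v) \<otimes>\<^bsub>F\<^esub> inv\<^bsub>F\<^esub> w \<in> H"
    "w \<otimes>\<^bsub>F\<^esub> u \<otimes>\<^bsub>F\<^esub> inv\<^bsub>F\<^esub> w \<in> K - H"
proof -
  interpret group F unfolding F_def by (rule group_free_group)
  interpret H: subgroup H F by fact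
  interpret K: subgroup K F by fact
  have cancel: "a \<otimes>\<^bsub>F\<^esub> (inv\<^bsub>F\<^esub> a \<otimes>\<^bsub>F\<^esub> x) = x" "inv\<^bsub>F\<^esub> a \<otimes>\<^bsub>F\<^esub> (a \<otimes>\<^bsub>F\<^esub> x) = x"
    if "a \<in> carrier F" "x \<in> carrier F" for a x
    using that by (simp_all add: m_assoc[symmetric])
  note gsimps = m_assoc inv_mult_group cancel
  \<comment> \<open>The length of a conjugate of h, to be minimized over all g and all nontrivial h
    in \<open>H\<close> at once.\<close>
  define f where "f = (\<lambda>(g, h). length (inv\<^bsub>F\<^esub> g \<otimes>\<^bsub>F\<^esub> h \<otimes>\<^bsub>F\<^esub> g))"
  obtain h0 where "h0 \<in> H - {\<one>\<^bsub>F\<^esub>}" using H1 H.one_closed by blast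
  then have "(\<one>\<^bsub>F\<^esub>, h0) \<in> carrier F \<times> (H - {\<one>\<^bsub>F\<^esub>})" by simp
  from ex_has_least_nat[of "\<lambda>p. p \<in> carrier F \<times> (H - {\<one>\<^bsub>F\<^esub>})", OF this, of f]
  obtain g h where gh: "g \<in> carrier F" "h \<in> H" "h \<noteq> \<one>\<^bsub>F\<^esub>"
    and min: "\<And>g' h'. g' \<in> carrier F \<Longrightarrow> h' \<in> H \<Longrightarrow> h' \<noteq> \<one>\<^bsub>F\<^esub> \<Longrightarrow> f (g, h) \<le> f (g', h')"
    by auto
  have hc: "h \<in> carrier F" using gh(2) by simp
  define c where "c = inv\<^bsub>F\<^esub> g \<otimes>\<^bsub>F\<^esub> h \<otimes>\<^bsub>F\<^esub> g"
  have c: "c \<in> carrier F" using gh(1) hc by (simp add: c_def)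
  have gc: "g \<otimes>\<^bsub>F\<^esub> c = h \<otimes>\<^bsub>F\<^esub> g" using gh(1) hc by (simp add: c_def gsimps)
  have "c \<noteq> \<one>\<^bsub>F\<^esub>"
  proof
    assume "c = \<one>\<^bsub>F\<^esub>"
    then have "h \<otimes>\<^bsub>F\<^esub> g = \<one>\<^bsub>F\<^esub> \<otimes>\<^bsub>F\<^esub> g" using gc gh(1) by simp
    then show False using gh(1,3) hc by (metis one_closed right_cancel)
  qed
  then have "c \<noteq> []" by (simp add: F_def free_group_def)
  \<comment> \<open>Conjugating c by x amounts to replacing g by gx, so minimality of the pair (g,
    h) applies.\<close>
  moreover have "length c \<le> length (inv\<^bsub>F\<^esub> x \<otimes>\<^bsub>F\<^esub> c \<otimes>\<^bsub>F\<^esub> x)" if "x \<in> carrier F" for x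
    using min[of "g \<otimes>\<^bsub>F\<^esub> x" h] gh hc that by (simp add: f_def c_def gsimps)
  ultimately have cyc: "hd c \<noteq> letter_inv (last c)"
    using c cyclically_reduced_of_shortest unfolding F_def by blast
  \<comment> \<open>Conjugation by g passes from h to c and from \<open>K - H\<close> to
    \<open>S\<close>, of which a shortest element is taken.\<close>
  define S where "S = {k \<in> carrier F. g \<otimes>\<^bsub>F\<^esub> k \<otimes>\<^bsub>F\<^esub> inv\<^bsub>F\<^esub> g \<in> K - H}"
  obtain k1 where k1: "k1 \<in> K - H" using HK by blast
  then have "inv\<^bsub>F\<^esub> g \<otimes>\<^bsub>F\<^esub> k1 \<otimes>\<^bsub>F\<^esub> g \<in> S" using gh(1) by (auto simp: S_def gsimps)
  from ex_has_least_nat[of "\<lambda>k. k \<in> S", OF this, of length]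
  obtain k where k: "k \<in> S" and kmin: "\<And>k'. k' \<in> S \<Longrightarrow> length k \<le> length k'" by blast
  have kc: "k \<in> carrier F" using k by (simp add: S_def)
  define k' where "k' = g \<otimes>\<^bsub>F\<^esub> k \<otimes>\<^bsub>F\<^esub> inv\<^bsub>F\<^esub> g"
  have k': "k' \<in> K" "k' \<notin> H" using k by (auto simp: S_def k'_def)
  \<comment> \<open>\<open>K - H\<close> is a union of right cosets of \<open>H\<close>.\<close>
  have coset: "x \<otimes>\<^bsub>F\<^esub> y \<in> K - H" if "x \<in> H" "y \<in> K" "y \<notin> H" for x y
  proof -
    have "y = inv\<^bsub>F\<^esub> x \<otimes>\<^bsub>F\<^esub> (x \<otimes>\<^bsub>F\<^esub> y)" using that by (simp add: cancel)
    then have "x \<otimes>\<^bsub>F\<^esub> y \<notin> H" using that H.m_inv_closed H.m_closed by metis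
    then show ?thesis using that HK by auto
  qed
  \<comment> \<open>Since g c g^-1 = h, multiplying k by c or its inverse stays in \<open>S\<close>
    and therefore, by the choice of k, does not shorten it.\<close>
  have "g \<otimes>\<^bsub>F\<^esub> (c \<otimes>\<^bsub>F\<^esub> k) \<otimes>\<^bsub>F\<^esub> inv\<^bsub>F\<^esub> g = h \<otimes>\<^bsub>F\<^esub> k'"
    "g \<otimes>\<^bsub>F\<^esub> (inv\<^bsub>F\<^esub> c \<otimes>\<^bsub>F\<^esub> k) \<otimes>\<^bsub>F\<^esub> inv\<^bsub>F\<^esub> g = inv\<^bsub>F\<^esub> h \<otimes>\<^bsub>F\<^esub> k'"
    using gh(1) hc kc by (simp_all add: k'_def c_def gsimps)
  then have "c \<otimes>\<^bsub>F\<^esub> k \<in> S" "inv\<^bsub>F\<^esub> c \<otimes>\<^bsub>F\<^esub> k \<in> S"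
    using coset[OF _ k'] gh(2) c kc by (simp_all add: S_def)
  then have red: "reduced_word ((inv\<^bsub>F\<^esub> k \<otimes>\<^bsub>F\<^esub> c) @ (c \<otimes>\<^bsub>F\<^esub> k))"
    using reduced_word_conjugate_square[of c Y k] c kc \<open>c \<noteq> []\<close> cyc kmin unfolding F_def by blast
  \<comment> \<open>Reducedness makes the concatenation equal to the product, which permits
    computing in the group.\<close>
  then have app: "(inv\<^bsub>F\<^esub> k \<otimes>\<^bsub>F\<^esub> c) @ (c \<otimes>\<^bsub>F\<^esub> k) = (inv\<^bsub>F\<^esub> k \<otimes>\<^bsub>F\<^esub> c) \<otimes>\<^bsub>F\<^esub> (c \<otimes>\<^bsub>F\<^esub> k)"
    using foldr_red_cons_append[OF red] by (simp add: F_def mult_free_group)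
  \<comment> \<open>The factor k undoes the k^-1 at the start of the word: with w = gk the whole
    word represents h^2, and the prefix k^-1 c represents h times the inverse of
    \<open>k'\<close>.\<close>
  let ?w = "g \<otimes>\<^bsub>F\<^esub> k"
  have "?w \<otimes>\<^bsub>F\<^esub> ((inv\<^bsub>F\<^esub> k \<otimes>\<^bsub>F\<^esub> c) @ (c \<otimes>\<^bsub>F\<^esub> k)) \<otimes>\<^bsub>F\<^esub> inv\<^bsub>F\<^esub> ?w = h \<otimes>\<^bsub>F\<^esub> h"
    unfolding app using gh(1) hc kc by (simp add: c_def gsimps)
  moreover have "?w \<otimes>\<^bsub>F\<^esub> (inv\<^bsub>F\<^esub> k \<otimes>\<^bsub>F\<^esub> c) \<otimes>\<^bsub>F\<^esub> inv\<^bsub>F\<^esub> ?w = h \<otimes>\<^bsub>F\<^esub> inv\<^bsub>F\<^esub> k'"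
    using gh(1) hc kc by (simp add: c_def k'_def gsimps)
  moreover have "inv\<^bsub>F\<^esub> k' \<in> K" "inv\<^bsub>F\<^esub> k' \<notin> H"
    using k' H.m_inv_closed[of "inv\<^bsub>F\<^esub> k'"] by auto
  ultimately show ?thesis
    using that[of ?w, OF _ _ _ red] gh(1,2) c kc coset[of h "inv\<^bsub>F\<^esub> k'"] by simp
qed

text \<open>Core graphs are determined only up to isomorphism, so non-injectivity is asserted for
  all representatives, and the existence clause guarantees that there are some. For trivial
  \<open>H\<close> the graph \<open>\<Gamma>\<^sub>B(H)\<close> is a single vertex and the morphism
  is injective for every basis, which explains the last hypothesis.\<close>

theorem corollary22:
  fixes Y :: "'y set" and H K :: "'y word set"
  assumes "subgroup H (free_group Y)"
    and "subgroup K (free_group Y)"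
    and "H \<subset> K"
    and "H \<noteq> {\<one>\<^bsub>free_group Y\<^esub>}"
  shows "\<exists>B. free_basis (free_group Y) B \<and>
    (\<exists>(\<Gamma> :: 'y coset_graph) (\<Delta> :: 'y coset_graph) \<phi>.
       is_core_graph_of (free_group Y) B H \<Gamma> \<and>
       is_core_graph_of (free_group Y) B K \<Delta> \<and>
       pl_morphism \<Gamma> \<Delta> \<phi>) \<and>
    (\<forall>(\<Gamma> :: 'y coset_graph) (\<Delta> :: 'y coset_graph) \<phi>.
       is_core_graph_of (free_group Y) B H \<Gamma> \<and>
       is_core_graph_of (free_group Y) B K \<Delta> \<and>
       pl_morphism \<Gamma> \<Delta> \<phi> \<longrightarrow> \<not> injective_morphism \<Gamma> \<phi>)"
proof -
  let ?F = "free_group Y"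
  interpret group ?F by (rule group_free_group)
  obtain w u v where w: "w \<in> carrier ?F" and uv: "u \<in> carrier ?F" "v \<in> carrier ?F"
    "reduced_word (u @ v)"
    and H: "w \<otimes>\<^bsub>?F\<^esub> (u @ v) \<otimes>\<^bsub>?F\<^esub> inv\<^bsub>?F\<^esub> w \<in> H"
    and K: "w \<otimes>\<^bsub>?F\<^esub> u \<otimes>\<^bsub>?F\<^esub> inv\<^bsub>?F\<^esub> w \<in> K - H"
    using exists_conjugator_with_prefix[OF assms] by blast
  let ?\<alpha> = "\<lambda>x. w \<otimes>\<^bsub>?F\<^esub> x \<otimes>\<^bsub>?F\<^esub> inv\<^bsub>?F\<^esub> w" and ?l = "\<lambda>y. [(y, True)]"
  define B where "B = ?\<alpha> ` ?l ` Y"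
  have iso: "?\<alpha> \<in> iso ?F ?F" by (rule conj_iso[OF w])
  have B: "free_basis ?F B"
    unfolding B_def by (rule free_basis_iso_image[OF is_group is_group iso free_basis_letters])
  have l: "?l ` Y \<subseteq> carrier ?F" by (auto simp: free_group_def reduced_word_def)
  \<comment> \<open>Replaces each letter y by the basis element w y w^-1. Distinct letters stay
    distinct, so reduced words over \<open>Y\<close> become reduced words over
    \<open>B\<close>.\<close>
  define t :: "'y word \<Rightarrow> 'y word word" where "t = map (apfst (?\<alpha> \<circ> ?l))"
  have eval: "word_eval ?F (t x) = ?\<alpha> x" if "x \<in> carrier ?F" for x
  proof -
    \<comment> \<open>Over the standard basis a reduced word evaluates to itself; applying the
      conjugation to every letter then conjugates the value.\<close>
    let ?x = "map (apfst ?l) x"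
    have x: "set x \<subseteq> Y \<times> UNIV" "reduced_word x" using that by (auto simp: free_group_def)
    have "word_eval ?F ?x = foldr red_cons (map (\<lambda>(b, s). (fst (hd b), s)) ?x) []"
      using x by (intro word_eval_free_group) auto
    also have "map (\<lambda>(b, s). (fst (hd b), s)) ?x = x" by (auto intro!: map_idI)
    finally have ev: "word_eval ?F ?x = x" using x by (simp add: foldr_red_cons_Nil)
    have "word_eval ?F (map (apfst ?\<alpha>) ?x) = ?\<alpha> (word_eval ?F ?x)"
      using x(1) l iso by (intro word_eval_map_hom is_group) (fastforce simp: iso_def)+
    then show ?thesis by (simp add: t_def ev apfst_compose comp_def)
  qed
  have uv_car: "u @ v \<in> carrier ?F" using uv by (simp add: free_group_def)
  have "inj_on ?\<alpha> (?l ` Y)"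
    using iso l by (auto simp: iso_def bij_betw_def intro: inj_on_subset)
  then have "inj_on (?\<alpha> \<circ> ?l) Y" by (intro comp_inj_on) (auto simp: inj_on_def)
  then have "t (u @ v) \<in> carrier (free_group B)"
    using reduced_word_map_apfst[of "?\<alpha> \<circ> ?l" Y "u @ v"] uv_car
    by (fastforce simp: t_def B_def free_group_def)
  then have car: "t u @ t v \<in> carrier (free_group B)" by (simp add: t_def)
  have "word_eval ?F (t u @ t v) \<in> H" using eval[OF uv_car] H by (simp add: t_def)
  moreover have "word_eval ?F (t u) \<in> K" "word_eval ?F (t u) \<notin> H"
    using eval[OF uv(1)] K by simp_all
  ultimately show ?thesis
    using B core_graph_morphism_exists[OF B assms(1,2) psubset_imp_subset[OF assms(3)]]
      not_injective_morphism_if_prefix[OF B _ _ _ car]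
    by blast
qed

end
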